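(* Let $k \geq 3$ be an integer and let $G$ be a graph on $n \geq 2^{2k}$ vertices. Then either $G$ contains no odd $k$-vertex subgraph or else $G$ contains at least $$\frac{1}{2^{2k^2+1}k^2n^2}\binom{n}{k}$$ odd $k$-vertex subgraphs.
   Context: All graphs are finite and simple. An odd $k$-vertex subgraph of $G$ is an induced subgraph $G[U]$, with $U\subseteq V(G)$ and $|U|=k$, having an odd number of edges; such subgraphs are counted by their vertex sets $U$. *)

theory Defs
  imports Complex_Main "HOL-Library.Ramsey"
begin

text \<open>Graphs are pairs of a vertex set \<open>V\<close> and a set \<open>E\<close> of two-element subsets of \<open>V\<close>, so
  loops and multiple edges are excluded by the representation.\<close>

definition finite_simple_graph :: "'a set \<Rightarrow> 'a set set \<Rightarrow> bool" where
  "finite_simple_graph V E \<longleftrightarrow> finite V \<and> E \<subseteq> nsets V 2"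

definition induced_edges :: "'a set set \<Rightarrow> 'a set \<Rightarrow> 'a set set" where
  "induced_edges E U = {e \<in> E. e \<subseteq> U}"

text \<open>Induced subgraphs are counted by their vertex sets (not up to isomorphism), hence
  represented by them.\<close>

definition odd_subgraphs :: "'a set \<Rightarrow> 'a set set \<Rightarrow> nat \<Rightarrow> 'a set set" where
  "odd_subgraphs V E k = {U \<in> nsets V k. odd (card (induced_edges E U))}"

end

theory Submission
  imports Defs
begin

text \<open>The number of edges induced by \<open>W\<close> is a quadratic polynomial in the indicator function
  of \<open>W\<close>, so its third differences vanish. Let \<open>H\<close> be any \<open>k\<close>-set of vertices and let \<open>W\<close> be
  an odd \<open>k\<close>-set with \<open>W - H\<close> of at least three elements. Three vertices of \<open>W - H\<close> can be
  exchanged, independently of one another, for three vertices of \<open>H - W\<close>, which gives eight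
  \<open>k\<close>-sets, and the alternating sum of their edge counts is zero (lemma
  \<open>edge_count_third_difference\<close>). Hence one of the seven sets other than \<open>W\<close> is odd as well, and
  it is closer to \<open>H\<close>. So as soon as some odd \<open>k\<close>-set exists, every \<open>k\<close>-set \<open>H\<close> has an odd
  \<open>k\<close>-set within two exchanges (lemma \<open>odd_subgraph_near\<close>).

  Conversely, at most \<open>k\<^sup>2 n\<^sup>2\<close> sets are within two exchanges of a given \<open>k\<close>-set: it suffices to
  name the two vertices that leave and the two that enter. Double counting gives
  \<open>n choose k \<le> k\<^sup>2 n\<^sup>2 N\<close> for the number \<open>N\<close> of odd \<open>k\<close>-sets, which is stronger than the claim
  by the factor \<open>2 ^ (2 * k\<^sup>2 + 1)\<close>.\<close>

lemma finite_induced_edges: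
  assumes "finite W"
  shows "finite (induced_edges E W)"
  using assms unfolding induced_edges_def by (auto intro: finite_subset[of _ "Pow W"])

lemma edge_count_insert:
  assumes E: "E \<subseteq> nsets V 2" and R: "finite R" "y \<notin> R"
  shows "card (induced_edges E (insert y R))
    = card (induced_edges E R) + card {u \<in> R. {y, u} \<in> E}"
proof -
  let ?D = "(\<lambda>u. {y, u}) ` {u \<in> R. {y, u} \<in> E}"
  have "induced_edges E (insert y R) \<subseteq> induced_edges E R \<union> ?D"
  proof
    fix e assume e: "e \<in> induced_edges E (insert y R)"
    then have "e \<in> nsets V 2" using E by (auto simp: induced_edges_def)
    then obtain p q where "e = {p, q}" "p \<noteq> q"
      by (auto simp: nsets_def card_2_iff)
    with e show "e \<in> induced_edges E R \<union> ?D"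
      by (auto simp: induced_edges_def insert_commute)
  qed
  then have "induced_edges E (insert y R) = induced_edges E R \<union> ?D"
    by (auto simp: induced_edges_def)
  moreover have "induced_edges E R \<inter> ?D = {}"
    using R by (auto simp: induced_edges_def)
  moreover have "card ?D = card {u \<in> R. {y, u} \<in> E}"
    using R by (intro card_image) (auto simp: inj_on_def doubleton_eq_iff)
  ultimately show ?thesis
    using R finite_induced_edges[OF R(1)] by (simp add: card_Un_disjoint)
qed

lemma degree_insert:
  assumes "finite R" "z \<notin> R"
  shows "card {u \<in> insert z R. {y, u} \<in> E}
    = card {u \<in> R. {y, u} \<in> E} + of_bool ({y, z} \<in> E)"
proof -
  have "{u \<in> insert z R. {y, u} \<in> E}
      = (if {y, z} \<in> E then insert z {u \<in> R. {y, u} \<in> E} else {u \<in> R. {y, u} \<in> E})"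
    by auto
  then show ?thesis using assms by simp
qed

text \<open>No term of this expansion involves all three of \<open>p\<close>, \<open>q\<close>, \<open>r\<close>; this is what makes
  third differences of the edge count vanish.\<close>

lemma edge_count_insert3:
  assumes "E \<subseteq> nsets V 2" "finite R" "p \<notin> R" "q \<notin> R" "r \<notin> R" "distinct [p, q, r]"
  shows "card (induced_edges E (insert p (insert q (insert r R))))
    = card (induced_edges E R)
      + card {u \<in> R. {p, u} \<in> E} + card {u \<in> R. {q, u} \<in> E} + card {u \<in> R. {r, u} \<in> E}
      + of_bool ({p, q} \<in> E) + of_bool ({p, r} \<in> E) + of_bool ({q, r} \<in> E)"
proof -
  have notin: "q \<notin> insert r R" "p \<notin> insert q (insert r R)"
    and fin: "finite (insert r R)" "finite (insert q (insert r R))"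
    using assms by auto
  have "card {u \<in> insert q (insert r R). {p, u} \<in> E}
      = card {u \<in> R. {p, u} \<in> E} + of_bool ({p, r} \<in> E) + of_bool ({p, q} \<in> E)"
    using degree_insert[OF fin(1) notin(1)] degree_insert[OF assms(2,5)] by metis
  moreover have "card {u \<in> insert r R. {q, u} \<in> E}
      = card {u \<in> R. {q, u} \<in> E} + of_bool ({q, r} \<in> E)"
    by (rule degree_insert[OF assms(2,5)])
  ultimately show ?thesis
    using edge_count_insert[OF assms(1) fin(2) notin(2)]
      edge_count_insert[OF assms(1) fin(1) notin(1)] edge_count_insert[OF assms(1,2,5)]
    by linarith
qed

text \<open>A term of the expansion that involves at most two of the three positions cancels in the
  alternating sum over the choice at a remaining position. The negative terms of that sum stand
  on the right, which keeps the identity within the natural numbers and leaves parity readable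
  from it.\<close>

lemma edge_count_third_difference:
  fixes E :: "'a set set" and R :: "'a set"
  defines "e \<equiv> \<lambda>p q r. card (induced_edges E (insert p (insert q (insert r R))))"
  assumes E: "E \<subseteq> nsets V 2" and R: "finite R"
    and disj: "R \<inter> {x1, x2, x3, a1, a2, a3} = {}"
    and dist: "distinct [x1, x2, x3, a1, a2, a3]"
  shows "e x1 x2 x3 + e a1 a2 x3 + e a1 x2 a3 + e x1 a2 a3
    = e a1 x2 x3 + e x1 a2 x3 + e x1 x2 a3 + e a1 a2 a3"
proof -
  define d where "d = (\<lambda>p. card {u \<in> R. {p, u} \<in> E})"
  define c :: "'a \<Rightarrow> 'a \<Rightarrow> nat" where "c = (\<lambda>p q. of_bool ({p, q} \<in> E))"
  have "e p q r = card (induced_edges E R) + d p + d q + d r + c p q + c p r + c q r"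
    if "p \<in> {x1, a1}" "q \<in> {x2, a2}" "r \<in> {x3, a3}" for p q r
  proof -
    have "p \<notin> R" "q \<notin> R" "r \<notin> R" "distinct [p, q, r]"
      using that disj dist by auto
    then show ?thesis
      unfolding e_def d_def c_def by (rule edge_count_insert3[OF E R])
  qed
  then show ?thesis by simp
qed

lemma obtain_three_elements:
  assumes "3 \<le> card A"
  obtains p q r where "{p, q, r} \<subseteq> A" "distinct [p, q, r]"
proof -
  obtain B where B: "B \<subseteq> A" "card B = 3"
    using assms by (meson obtain_subset_with_card_n)
  then obtain p q r where "B = {p, q, r}" "distinct [p, q, r]"
    by (auto simp: card_3_iff)
  with B that show thesis by blast
qed

text \<open>An odd \<open>k\<close>-set that is closest to \<open>H\<close> must be this close: if it had three vertices
  outside \<open>H\<close>, the vanishing third difference would give an odd \<open>k\<close>-set with fewer.\<close>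

lemma odd_subgraph_near:
  assumes E: "E \<subseteq> nsets V 2"
    and H: "H \<in> nsets V k" and ex: "odd_subgraphs V E k \<noteq> {}"
  shows "\<exists>W \<in> odd_subgraphs V E k. card (W - H) \<le> 2"
proof -
  obtain W where W: "W \<in> odd_subgraphs V E k"
    and least: "\<And>W'. W' \<in> odd_subgraphs V E k \<Longrightarrow> card (W - H) \<le> card (W' - H)"
    using ex ex_has_least_nat[of "\<lambda>W. W \<in> odd_subgraphs V E k" _ "\<lambda>W. card (W - H)"]
    by blast
  have WV: "W \<subseteq> V" "finite W" "card W = k"
    and oddW: "odd (card (induced_edges E W))"
    using W by (auto simp: odd_subgraphs_def nsets_def)
  have HV: "H \<subseteq> V" "finite H" "card H = k"
    using H by (auto simp: nsets_def)
  have "card (W - H) \<le> 2"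
  proof (rule ccontr)
    assume "\<not> card (W - H) \<le> 2"
    then have three: "3 \<le> card (W - H)" by simp
    moreover have "card (H - W) = card (W - H)"
      using WV HV by (simp add: card_Diff_subset_Int Int_commute)
    ultimately have three': "3 \<le> card (H - W)" by simp
    obtain x1 x2 x3 where x: "{x1, x2, x3} \<subseteq> W - H" "distinct [x1, x2, x3]"
      using three by (rule obtain_three_elements)
    obtain a1 a2 a3 where a: "{a1, a2, a3} \<subseteq> H - W" "distinct [a1, a2, a3]"
      using three' by (rule obtain_three_elements)
    define R where "R = W - {x1, x2, x3}"
    have R: "finite R" "R \<inter> {x1, x2, x3, a1, a2, a3} = {}"
      using WV a unfolding R_def by auto
    have W_eq: "W = insert x1 (insert x2 (insert x3 R))"
      using x unfolding R_def by auto
    have k: "k = card R + 3"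
      using WV(3) R x(2) by (simp add: W_eq)
    define e where "e = (\<lambda>p q r. card (induced_edges E (insert p (insert q (insert r R)))))"
    have exchanged_even: "even (e p q r)"
      if "p \<in> {x1, a1}" "q \<in> {x2, a2}" "r \<in> {x3, a3}" "a1 = p \<or> a2 = q \<or> a3 = r" for p q r
    proof -
      define W' where "W' = insert p (insert q (insert r R))"
      have "p \<notin> R" "q \<notin> R" "r \<notin> R" "distinct [p, q, r]"
        using that R x a by auto
      then have "card W' = k" using R k by (simp add: W'_def)
      moreover have "W' \<subseteq> V"
        using that x a WV HV unfolding W'_def R_def by auto
      ultimately have W'k: "W' \<in> nsets V k"
        using R by (simp add: nsets_def W'_def)
      have "W' - H \<subset> W - H"
      proof
        show "W' - H \<subseteq> W - H"
          using that a unfolding W'_def W_eq by auto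
        have "\<exists>v \<in> {x1, x2, x3}. v \<notin> W'"
          using that R x a unfolding W'_def by auto
        then show "W' - H \<noteq> W - H" using x by auto
      qed
      then have "card (W' - H) < card (W - H)"
        using WV by (intro psubset_card_mono) auto
      then have "W' \<notin> odd_subgraphs V E k"
        using least by (meson not_less)
      then show ?thesis
        using W'k by (simp add: odd_subgraphs_def W'_def e_def)
    qed
    have "distinct [x1, x2, x3, a1, a2, a3]" using x a by auto
    from edge_count_third_difference[OF E R this]
    have "e x1 x2 x3 + e a1 a2 x3 + e a1 x2 a3 + e x1 a2 a3
        = e a1 x2 x3 + e x1 a2 x3 + e x1 x2 a3 + e a1 a2 a3"
      by (simp add: e_def)
    moreover have "even (e a1 a2 x3)" "even (e a1 x2 a3)" "even (e x1 a2 a3)"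
        "even (e a1 x2 x3)" "even (e x1 a2 x3)" "even (e x1 x2 a3)" "even (e a1 a2 a3)"
      by (simp_all add: exchanged_even)
    ultimately have "even (e x1 x2 x3)" by presburger
    then show False using oddW by (simp add: e_def W_eq)
  qed
  with W show ?thesis by blast
qed

lemma card_le_2_obtain_pair:
  assumes "card A \<le> 2" "finite A" "A \<noteq> {}"
  obtains p q where "A = {p, q}"
proof -
  have "card A = 1 \<or> card A = 2"
    using assms by (metis One_nat_def card_gt_0_iff le_SucE le_zero_eq less_irrefl numeral_2_eq_2)
  then show thesis
    using that by (auto simp: card_1_singleton_iff card_2_iff)
qed

text \<open>A single exchange and the empty exchange are also of the form
  \<open>(W - {p, q}) \<union> {y, z}\<close>, with \<open>p = q\<close> and \<open>y = z\<close>, so that \<open>k\<^sup>2 n\<^sup>2\<close> quadruples cover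
  every case.\<close>

lemma card_near_sets_le:
  assumes fin: "finite V" and W: "W \<in> nsets V k" and k: "0 < k"
  shows "card {H \<in> nsets V k. card (W - H) \<le> 2} \<le> k\<^sup>2 * (card V)\<^sup>2"
proof -
  let ?Q = "(W \<times> W) \<times> (V \<times> V)"
  let ?f = "\<lambda>((p, q), (y, z)). (W - {p, q}) \<union> {y, z}"
  have WV: "W \<subseteq> V" "finite W" "card W = k"
    using W by (auto simp: nsets_def)
  have "{H \<in> nsets V k. card (W - H) \<le> 2} \<subseteq> ?f ` ?Q"
  proof
    fix H assume "H \<in> {H \<in> nsets V k. card (W - H) \<le> 2}"
    then have HV: "H \<subseteq> V" "finite H" "card H = k" and near: "card (W - H) \<le> 2"
      by (auto simp: nsets_def)
    have same: "card (H - W) = card (W - H)"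
      using WV HV by (simp add: card_Diff_subset_Int Int_commute)
    show "H \<in> ?f ` ?Q"
    proof (cases "W = H")
      case True
      obtain v where "v \<in> W" using WV k by fastforce
      then have "((v, v), (v, v)) \<in> ?Q" "H = ?f ((v, v), (v, v))"
        using True WV by auto
      then show ?thesis by (metis (no_types, lifting) image_eqI)
    next
      case False
      have "W - H \<noteq> {}"
        using False WV HV by (metis Diff_eq_empty_iff card_subset_eq)
      moreover from this have "H - W \<noteq> {}"
        using same WV HV by (metis card_0_eq card.empty finite_Diff)
      ultimately obtain p q y z where pq: "W - H = {p, q}" and yz: "H - W = {y, z}"
        using near same WV HV by (metis card_le_2_obtain_pair finite_Diff)
      have "((p, q), (y, z)) \<in> ?Q" using pq yz HV by auto
      moreover have "H = (W - (W - H)) \<union> (H - W)" by auto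
      then have "H = ?f ((p, q), (y, z))" by (simp add: pq yz)
      ultimately show ?thesis by (metis (no_types, lifting) image_eqI)
    qed
  qed
  then have "card {H \<in> nsets V k. card (W - H) \<le> 2} \<le> card ?Q"
    using WV fin by (intro surj_card_le) auto
  also have "\<dots> = k\<^sup>2 * (card V)\<^sup>2"
    using WV by (simp add: card_cartesian_product power2_eq_square)
  finally show ?thesis .
qed

lemma choose_le_odd_subgraphs:
  assumes fin: "finite V" and E: "E \<subseteq> nsets V 2" and k: "0 < k"
    and ex: "odd_subgraphs V E k \<noteq> {}"
  shows "card V choose k \<le> card (odd_subgraphs V E k) * (k\<^sup>2 * (card V)\<^sup>2)"
proof -
  let ?O = "odd_subgraphs V E k"
  let ?N = "\<lambda>W. {H \<in> nsets V k. card (W - H) \<le> 2}"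
  have finO: "finite ?O"
    using fin by (simp add: odd_subgraphs_def finite_imp_finite_nsets)
  have "nsets V k \<subseteq> (\<Union>W\<in>?O. ?N W)"
    using odd_subgraph_near[OF E _ ex] by blast
  then have "card (nsets V k) \<le> card (\<Union>W\<in>?O. ?N W)"
    using finO fin by (intro card_mono) (auto simp: finite_imp_finite_nsets)
  also have "\<dots> \<le> (\<Sum>W\<in>?O. card (?N W))"
    using finO by (rule card_UN_le)
  also have "\<dots> \<le> (\<Sum>W\<in>?O. k\<^sup>2 * (card V)\<^sup>2)"
    using card_near_sets_le[OF fin _ k] by (intro sum_mono) (auto simp: odd_subgraphs_def)
  finally show ?thesis by simp
qed

theorem theorem3p11:
  fixes V :: "'a set" and E :: "'a set set" and k n :: nat
  assumes "k \<ge> 3"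
    and "finite_simple_graph V E"
    and "card V = n"
    and "n \<ge> 2 ^ (2 * k)"
  shows "odd_subgraphs V E k = {} \<or>
    real (card (odd_subgraphs V E k))
      \<ge> 1 / (2 ^ (2 * k\<^sup>2 + 1) * (real k)\<^sup>2 * (real n)\<^sup>2) * real (n choose k)"
proof (cases "odd_subgraphs V E k = {}")
  case False
  define N where "N = card (odd_subgraphs V E k)"
  have "n choose k \<le> N * (k\<^sup>2 * n\<^sup>2)"
    using choose_le_odd_subgraphs[of V E k] False assms
    by (simp add: finite_simple_graph_def N_def)
  then have "real (n choose k) \<le> real (N * (k\<^sup>2 * n\<^sup>2))"
    by (simp only: of_nat_le_iff)
  also have "\<dots> = 1 * (real N * ((real k)\<^sup>2 * (real n)\<^sup>2))" by simp
  also have "\<dots> \<le> 2 ^ (2 * k\<^sup>2 + 1) * (real N * ((real k)\<^sup>2 * (real n)\<^sup>2))"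
    by (intro mult_right_mono one_le_power) auto
  finally have bound:
    "real (n choose k) \<le> real N * (2 ^ (2 * k\<^sup>2 + 1) * (real k)\<^sup>2 * (real n)\<^sup>2)"
    by (simp only: mult_ac)
  have "0 < n" using assms(4) by (metis gr0I not_le zero_less_numeral zero_less_power)
  then have "0 < 2 ^ (2 * k\<^sup>2 + 1) * (real k)\<^sup>2 * (real n)\<^sup>2"
    using assms(1) by simp
  with bound have "real (n choose k) / (2 ^ (2 * k\<^sup>2 + 1) * (real k)\<^sup>2 * (real n)\<^sup>2) \<le> real N"
    by (simp only: pos_divide_le_eq)
  then show ?thesis by (simp add: N_def)
qed simp

end
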